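(* Let $S$ be a semigroup. For $i=1,2$ let $a_i,b_i,c_i\in S$ and suppose that $a_i$ is $(b_i,c_i)$-invertible with $(b_i,c_i)$-inverse $x_i\in S$. Then for any $y\in S^1$ the following are equivalent: (1) $yx_1=x_2y$; (2) $c_2ya_1b_1=c_2a_2yb_1$, $yb_1\in b_2S$, and $c_2y\in Sc_1$; (3) $c_2ya_1b_1=c_2a_2yb_1$, $yb_1=x_2a_2yb_1$, and $c_2y=c_2ya_1x_1$.
   Context: For $a,b,c\in S$, an element $x\in S$ is a $(b,c)$-inverse of $a$ if $xab=b$, $cax=c$, $x\in bSx$, and $x\in xSc$ (equivalently $xab=b$, $cax=c$, $x\in bS$, $x\in Sc$); such $x$ is unique when it exists, and $a$ is then called $(b,c)$-invertible. Here $bS=\{bs:s\in S\}$, $Sc=\{sc:s\in S\}$, etc. $S^1$ denotes the monoid equal to $S$ if $S$ has an identity element and to $S\cup\{1\}$ (with an identity $1$ adjoined) otherwise. *)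

theory Defs
  imports Main
begin

definition is_identity :: "'a::semigroup_mult \<Rightarrow> bool" where
  "is_identity e \<longleftrightarrow> (\<forall>s. e * s = s \<and> s * e = s)"

text \<open>
  The monoid \<open>S\<^sup>1\<close> of a semigroup \<open>S\<close> (a type of class \<open>semigroup_mult\<close>).
  \<open>Some s\<close> stands for \<open>s \<in> S\<close>; the adjoined identity \<open>None\<close> belongs to the type only if
  \<open>S\<close> has no (two-sided) identity element.
\<close>

typedef (overloaded) 'a adjoin_one =
  "{u :: ('a::semigroup_mult) option. u = None \<longrightarrow> \<not> (\<exists>e::'a. is_identity e)}"
  by (rule exI[where x = "Some undefined"]) simp

setup_lifting type_definition_adjoin_one

lift_definition emb :: "'a::semigroup_mult \<Rightarrow> 'a adjoin_one" is Some
  by simp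

instantiation adjoin_one :: (semigroup_mult) monoid_mult
begin

lift_definition one_adjoin_one :: "'a adjoin_one" is
  "if \<exists>e::'a. is_identity e
   then Some (SOME e::'a. is_identity e) else None"
  by (auto split: if_splits)

lift_definition times_adjoin_one :: "'a adjoin_one \<Rightarrow> 'a adjoin_one \<Rightarrow> 'a adjoin_one" is
  "\<lambda>u v. case u of None \<Rightarrow> v | Some s \<Rightarrow> (case v of None \<Rightarrow> Some s | Some t \<Rightarrow> Some (s * t))"
  by (auto split: option.splits)

instance
proof
  fix u v w :: "'a adjoin_one"
  show "u * v * w = u * (v * w)"
    by transfer (auto split: option.splits simp: mult.assoc)
  have some_id: "(SOME e::'a. is_identity e) * s = s" "s * (SOME e::'a. is_identity e) = s"
    if "\<exists>e::'a. is_identity e" for s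
    using someI_ex[OF that] unfolding is_identity_def by blast+
  show "1 * u = u"
    by transfer (auto simp: some_id split: option.splits)
  show "u * 1 = u"
    by transfer (auto simp: some_id split: option.splits)
qed

end

lemma emb_mult: "emb (s * t) = emb s * emb t"
  by transfer simp

lemma inj_emb: "inj emb"
  by (rule injI) (transfer, simp)

lemma range_emb_if_identity:
  assumes "\<exists>e::'a::semigroup_mult. is_identity e"
  shows "range (emb :: 'a \<Rightarrow> 'a adjoin_one) = UNIV"
proof -
  have "\<exists>s. u = emb s" for u :: "'a adjoin_one"
    using assms by transfer auto
  then show ?thesis by blast
qed

lemma range_emb_if_no_identity:
  assumes "\<not> (\<exists>e::'a::semigroup_mult. is_identity e)"
  shows "range (emb :: 'a \<Rightarrow> 'a adjoin_one) = UNIV - {1}"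
proof -
  have "(\<exists>s. u = emb s) \<longleftrightarrow> u \<noteq> 1" for u :: "'a adjoin_one"
    using assms by transfer (auto simp: not_None_eq)
  then show ?thesis by blast
qed

definition is_bc_inverse :: "'a::semigroup_mult \<Rightarrow> 'a \<Rightarrow> 'a \<Rightarrow> 'a \<Rightarrow> bool" where
  "is_bc_inverse a b c x \<longleftrightarrow>
     x * a * b = b \<and> c * a * x = c \<and> x \<in> {b * s * x | s. True} \<and> x \<in> {x * s * c | s. True}"

end

theory Submission
  imports Defs
begin

text \<open>
  The defining equations of a \<open>(b, c)\<close>-inverse \<open>x\<close> of \<open>a\<close> say that \<open>x * a\<close> is a left identity for
  \<open>b\<close> and \<open>a * x\<close> is a right identity for \<open>c\<close>, while \<open>x\<close> itself is a right multiple of \<open>b\<close> and a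
  left multiple of \<open>c\<close>.  Hence \<open>x * a\<close> fixes from the left exactly the right multiples of \<open>b\<close>, and
  \<open>a * x\<close> fixes from the right exactly the left multiples of \<open>c\<close>.  This turns the two membership
  conditions \<open>y b\<^sub>1 \<in> b\<^sub>2 S\<close> and \<open>c\<^sub>2 y \<in> S c\<^sub>1\<close> of (2) into the two equations of (3).

  For (3) and (1), the two fixing equations give \<open>y x\<^sub>1 = x\<^sub>2 a\<^sub>2 y x\<^sub>1\<close> and \<open>x\<^sub>2 y = x\<^sub>2 y a\<^sub>1 x\<^sub>1\<close>, because
  \<open>x\<^sub>1\<close> starts with \<open>b\<^sub>1\<close> and \<open>x\<^sub>2\<close> ends with \<open>c\<^sub>2\<close>.  For the same reason the remaining equation
  \<open>c\<^sub>2 y a\<^sub>1 b\<^sub>1 = c\<^sub>2 a\<^sub>2 y b\<^sub>1\<close> identifies the two right-hand sides.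

  Conversely, given (1), moving \<open>y\<close> across gives \<open>y b\<^sub>1 = y x\<^sub>1 a\<^sub>1 b\<^sub>1 = x\<^sub>2 y a\<^sub>1 b\<^sub>1\<close> and
  \<open>c\<^sub>2 y = c\<^sub>2 a\<^sub>2 x\<^sub>2 y = c\<^sub>2 a\<^sub>2 y x\<^sub>1\<close>.  The fixing equations follow since \<open>x\<^sub>i a\<^sub>i x\<^sub>i = x\<^sub>i\<close>, and the remaining
  one by multiplying the second of these by \<open>a\<^sub>1 b\<^sub>1\<close>.

  The equivalence of (1) and (3) involves nothing but products, so it is proved for \<open>y\<close> in an
  arbitrary semigroup and then applied in \<open>S\<^sup>1\<close>, into which the embedding carries \<open>(b, c)\<close>-inverses.
  Only (2) distinguishes \<open>S\<close> from \<open>S\<^sup>1\<close>; there one uses that \<open>S\<close> is an ideal of \<open>S\<^sup>1\<close>.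
\<close>

lemma is_bc_inverseE:
  assumes "is_bc_inverse a b c x"
  obtains p q where "x * a * b = b" "c * a * x = c" "x = b * p * x" "x = x * q * c"
  using assms unfolding is_bc_inverse_def by blast

lemma is_bc_inverse_outer:
  assumes "is_bc_inverse a b c x"
  shows "x * a * x = x"
  using assms by (elim is_bc_inverseE) (metis mult.assoc)

lemma is_bc_inverse_emb:
  assumes "is_bc_inverse a b c x"
  shows "is_bc_inverse (emb a) (emb b) (emb c) (emb x)"
proof -
  obtain p q where "x * a * b = b" "c * a * x = c" "x = b * p * x" "x = x * q * c"
    using assms by (rule is_bc_inverseE)
  then have "emb x * emb a * emb b = emb b" "emb c * emb a * emb x = emb c"
    "emb x = emb b * emb p * emb x" "emb x = emb x * emb q * emb c"
    by (simp_all flip: emb_mult)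
  then show ?thesis
    unfolding is_bc_inverse_def by blast
qed

lemma intertwining_iff_equations:
  fixes a1 b1 c1 x1 a2 b2 c2 x2 y :: "'a::semigroup_mult"
  assumes inv1: "is_bc_inverse a1 b1 c1 x1"
    and inv2: "is_bc_inverse a2 b2 c2 x2"
  shows "y * x1 = x2 * y
    \<longleftrightarrow> c2 * y * a1 * b1 = c2 * a2 * y * b1
        \<and> y * b1 = x2 * a2 * y * b1
        \<and> c2 * y = c2 * y * a1 * x1"
    (is "?intertwine \<longleftrightarrow> ?mid \<and> ?left \<and> ?right")
proof -
  obtain p where b1: "x1 * a1 * b1 = b1" and x1: "x1 = b1 * p * x1"
    using inv1 by (rule is_bc_inverseE)
  obtain q where c2: "c2 * a2 * x2 = c2" and x2: "x2 = x2 * q * c2"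
    using inv2 by (rule is_bc_inverseE)
  show ?thesis
  proof (intro iffI conjI; (elim conjE)?)
    assume comm: ?intertwine
    have yb1: "y * b1 = x2 * y * a1 * b1"
      using arg_cong[OF b1, of "\<lambda>z. y * z"] comm by (simp flip: mult.assoc)
    have c2y: "c2 * y = c2 * a2 * y * x1"
      using arg_cong[OF c2, of "\<lambda>z. z * y"] comm by (simp add: mult.assoc)
    show ?mid
      using c2y b1 by (metis mult.assoc)
    show ?left
      using yb1 is_bc_inverse_outer[OF inv2] by (metis mult.assoc)
    show ?right
      using c2y is_bc_inverse_outer[OF inv1] by (metis mult.assoc)
  next
    assume mid: ?mid and left: ?left and right: ?right
    \<comment> \<open>Both ends are brought to the common value \<open>x2 * y * a1 * x1\<close>: on the left \<open>x1\<close> is expanded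
      to expose \<open>b1\<close>, so that the left and the middle equation apply, and on the right
      \<open>x2\<close> is expanded to expose \<open>c2\<close>.\<close>
    have "y * x1 = (y * b1) * p * x1"
      using x1 by (metis mult.assoc)
    also have "\<dots> = x2 * a2 * y * (b1 * p * x1)"
      by (subst left) (simp add: mult.assoc)
    also have "\<dots> = x2 * a2 * y * x1"
      using x1 by simp
    also have "\<dots> = x2 * q * (c2 * a2 * y * b1) * p * x1"
      using x1 x2 by (metis mult.assoc)
    also have "\<dots> = x2 * q * (c2 * y * a1 * b1) * p * x1"
      using mid by simp
    also have "\<dots> = (x2 * q) * (c2 * y * a1 * x1)"
      using x1 by (metis mult.assoc)
    also have "\<dots> = (x2 * q) * (c2 * y)"
      using right by simp
    also have "\<dots> = x2 * y"
      using x2 by (metis mult.assoc)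
    finally show ?intertwine .
  qed
qed

lemma mult_emb_in_range: "u * emb s \<in> range emb"
proof -
  have "\<exists>t. u * emb s = emb t"
    by transfer (auto split: option.splits)
  then show ?thesis by blast
qed

lemma emb_mult_in_range: "emb s * u \<in> range emb"
proof -
  have "\<exists>t. emb s * u = emb t"
    by transfer (auto split: option.splits)
  then show ?thesis by blast
qed

text \<open>
  Membership in \<open>b S\<close> must be witnessed by an element of \<open>S\<close>, whereas the equation \<open>u = x a u\<close> yields
  the cofactor \<open>p x a u\<close> with \<open>u\<close> in \<open>S\<^sup>1\<close>; the ideal property puts this cofactor back into \<open>S\<close>.
\<close>

lemma in_right_ideal_iff:
  assumes inv: "is_bc_inverse a b c x"
  shows "u \<in> emb ` {b * s | s. True} \<longleftrightarrow> u = emb x * emb a * u"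
proof -
  obtain p where b: "x * a * b = b" and x: "x = b * p * x"
    using inv by (rule is_bc_inverseE)
  show ?thesis
  proof
    assume "u \<in> emb ` {b * s | s. True}"
    then obtain s where "u = emb (b * s)" by blast
    moreover have "x * a * (b * s) = b * s"
      using b by (metis mult.assoc)
    ultimately show "u = emb x * emb a * u"
      by (simp flip: emb_mult)
  next
    assume u: "u = emb x * emb a * u"
    obtain t where t: "emb (p * x * a) * u = emb t"
      using emb_mult_in_range by blast
    have "emb x = emb b * emb p * emb x"
      using x by (simp flip: emb_mult)
    then have "u = emb b * (emb (p * x * a) * u)"
      using u by (metis emb_mult mult.assoc)
    then have "u = emb (b * t)"
      using t by (simp add: emb_mult)
    then show "u \<in> emb ` {b * s | s. True}" by blast
  qed
qed

lemma in_left_ideal_iff: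
  assumes inv: "is_bc_inverse a b c x"
  shows "u \<in> emb ` {s * c | s. True} \<longleftrightarrow> u = u * emb a * emb x"
proof -
  obtain q where c: "c * a * x = c" and x: "x = x * q * c"
    using inv by (rule is_bc_inverseE)
  show ?thesis
  proof
    assume "u \<in> emb ` {s * c | s. True}"
    then obtain s where "u = emb (s * c)" by blast
    moreover have "s * c * a * x = s * c"
      using c by (metis mult.assoc)
    ultimately show "u = u * emb a * emb x"
      by (simp flip: emb_mult)
  next
    assume u: "u = u * emb a * emb x"
    obtain t where t: "u * emb (a * x * q) = emb t"
      using mult_emb_in_range by blast
    have "emb x = emb x * emb q * emb c"
      using x by (simp flip: emb_mult)
    then have "u = u * emb (a * x * q) * emb c"
      using u by (metis emb_mult mult.assoc)
    then have "u = emb (t * c)"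
      using t by (simp add: emb_mult)
    then show "u \<in> emb ` {s * c | s. True}" by blast
  qed
qed

theorem theorem3p5:
  fixes a1 b1 c1 x1 a2 b2 c2 x2 :: "'a::semigroup_mult"
    and y :: "'a adjoin_one"
  assumes "is_bc_inverse a1 b1 c1 x1"
    and "is_bc_inverse a2 b2 c2 x2"
  shows "(y * emb x1 = emb x2 * y
      \<longleftrightarrow> emb c2 * y * emb a1 * emb b1 = emb c2 * emb a2 * y * emb b1
          \<and> y * emb b1 \<in> emb ` {b2 * s | s. True}
          \<and> emb c2 * y \<in> emb ` {s * c1 | s. True})
    \<and> (y * emb x1 = emb x2 * y
      \<longleftrightarrow> emb c2 * y * emb a1 * emb b1 = emb c2 * emb a2 * y * emb b1
          \<and> y * emb b1 = emb x2 * emb a2 * y * emb b1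
          \<and> emb c2 * y = emb c2 * y * emb a1 * emb x1)"
proof -
  have "y * emb b1 \<in> emb ` {b2 * s | s. True}
      \<longleftrightarrow> y * emb b1 = emb x2 * emb a2 * y * emb b1"
    using in_right_ideal_iff[OF assms(2), of "y * emb b1"] by (simp add: mult.assoc)
  moreover have "emb c2 * y \<in> emb ` {s * c1 | s. True}
      \<longleftrightarrow> emb c2 * y = emb c2 * y * emb a1 * emb x1"
    by (rule in_left_ideal_iff[OF assms(1)])
  moreover note intertwining_iff_equations
    [OF assms[THEN is_bc_inverse_emb], of y]
  ultimately show ?thesis by simp
qed

end
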